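(* For every integer $n\geq 0$, $$G_n=-(2^n-1)B_n,$$ where $B_n$ are the Bernoulli numbers and $G_n$ are the Genocchi numbers, defined by $\frac{z}{e^z-1}=\sum_{n=0}^{\infty}\frac{B_n}{n!}z^n$ and $\frac{z}{e^z+1}=\sum_{n=0}^{\infty}\frac{G_n}{n!}z^n$.
   Context: The numbers $B_n$ and $G_n$ are the coefficients of the power series expansions at $z=0$ (equivalently, of formal power series in $z$): $$\frac{z}{e^z-1}=\sum_{n=0}^{\infty}\frac{B_n}{n!}z^n,\qquad \frac{z}{e^z+1}=\sum_{n=0}^{\infty}\frac{G_n}{n!}z^n.$$ Note the normalization: the numerator in the second generating function is $z$ (not $2z$). *)

theory Defs
  imports Complex_Main "HOL-Computational_Algebra.Formal_Power_Series"
begin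

text \<open>The divisions below are in the ring of formal power series: dividing by \<open>fps_exp 1 - 1\<close>,
  which has zero constant term, yields the exact quotient because it divides \<open>fps_X\<close>
  (see \<open>bernoulli_gen\<close>). In the second series the numerator is \<open>z\<close>, not \<open>2z\<close>.\<close>

definition bernoulli :: "nat \<Rightarrow> real" where
  "bernoulli n = fact n * fps_nth (fps_X / (fps_exp 1 - 1)) n"

definition genocchi :: "nat \<Rightarrow> real" where
  "genocchi n = fact n * fps_nth (fps_X / (fps_exp 1 + 1)) n"

lemma bernoulli_gen:
  "Abs_fps (\<lambda>n. bernoulli n / fact n) = fps_X / (fps_exp 1 - 1)"
  "Abs_fps (\<lambda>n. bernoulli n / fact n) * (fps_exp 1 - 1) = fps_X"
proof -
  show *: "Abs_fps (\<lambda>n. bernoulli n / fact n) = fps_X / (fps_exp 1 - 1)"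
    by (rule fps_ext) (simp add: bernoulli_def)
  have nz: "fps_nth (fps_exp (1::real) - 1) 1 \<noteq> 0" by simp
  then have "fps_exp (1::real) - 1 \<noteq> 0" by (metis fps_zero_nth)
  moreover have "subdegree (fps_exp (1::real) - 1) \<le> subdegree (fps_X :: real fps)"
    using nz by (simp add: subdegree_leI)
  ultimately have "(fps_exp (1::real) - 1) dvd fps_X"
    by (simp add: fps_dvd_iff)
  then show "Abs_fps (\<lambda>n. bernoulli n / fact n) * (fps_exp 1 - 1) = fps_X"
    unfolding * by (rule dvd_div_mult_self)
qed

lemma genocchi_gen:
  "Abs_fps (\<lambda>n. genocchi n / fact n) = fps_X / (fps_exp 1 + 1)"
  "Abs_fps (\<lambda>n. genocchi n / fact n) * (fps_exp 1 + 1) = fps_X"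
proof -
  show *: "Abs_fps (\<lambda>n. genocchi n / fact n) = fps_X / (fps_exp 1 + 1)"
    by (rule fps_ext) (simp add: genocchi_def)
  have "fps_nth (fps_exp (1::real) + 1) 0 \<noteq> 0" by simp
  then have "(fps_exp (1::real) + 1) dvd fps_X"
    by (metis fps_is_unit_iff unit_imp_dvd)
  then show "Abs_fps (\<lambda>n. genocchi n / fact n) * (fps_exp 1 + 1) = fps_X"
    unfolding * by (rule dvd_div_mult_self)
qed

end

theory Submission imports Defs begin

text \<open>
  Both numbers are read off from the partial fraction identity
  \<open>z / (e\<^sup>z + 1) = z / (e\<^sup>z - 1) - 2z / (e\<^sup>2\<^sup>z - 1)\<close>,
  which holds because \<open>e\<^sup>2\<^sup>z - 1 = (e\<^sup>z - 1) (e\<^sup>z + 1)\<close>. Its last term is the Bernoulli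
  series with \<open>z\<close> replaced by \<open>2z\<close>, so comparing coefficients gives
  \<open>G\<^sub>n = B\<^sub>n - 2\<^sup>n B\<^sub>n\<close>.
\<close>

theorem mainTheorem3:
  fixes n :: nat
  shows "genocchi n = - (2 ^ n - 1) * bernoulli n"
proof -
  define B where "B = Abs_fps (\<lambda>n. bernoulli n / fact n)"
  define G where "G = Abs_fps (\<lambda>n. genocchi n / fact n)"
  define B2 where "B2 = B oo (fps_const 2 * fps_X)"
  define E where "E = fps_exp (1::real)"
  have B: "B * (E - 1) = fps_X" and G: "G * (E + 1) = fps_X"
    unfolding B_def G_def E_def by (rule bernoulli_gen(2) genocchi_gen(2))+
  have E2: "E oo (fps_const 2 * fps_X) = E * E"
    by (simp add: E_def fps_exp_compose_linear flip: fps_exp_add_mult)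
  have "(B * (E - 1)) oo (fps_const 2 * fps_X) = B2 * (E * E - 1)"
    unfolding B2_def E2 [symmetric]
    by (subst fps_compose_mult_distrib) (simp_all add: fps_compose_sub_distrib)
  then have B2: "B2 * (E * E - 1) = 2 * fps_X"
    by (simp add: B numeral_fps_const)
  have "fps_nth (E * E - 1) 1 \<noteq> 0"
    by (simp add: E_def flip: fps_exp_add_mult)
  then have nz: "E * E - 1 \<noteq> 0" by (metis fps_zero_nth)
  have "G * (E * E - 1) = (G * (E + 1)) * (E - 1)"
    by (simp add: algebra_simps)
  also have "\<dots> = fps_X * (E + 1) - 2 * fps_X"
    unfolding G by (simp add: algebra_simps)
  also have "\<dots> = (B * (E - 1)) * (E + 1) - B2 * (E * E - 1)"
    by (simp only: B B2)
  also have "\<dots> = (B - B2) * (E * E - 1)"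
    by (simp add: algebra_simps)
  finally have "G = B - B2" using nz mult_right_cancel by blast
  then have "fps_nth G n = fps_nth B n - fps_nth B2 n" by simp
  then have "genocchi n / fact n = bernoulli n / fact n - 2 ^ n * (bernoulli n / fact n)"
    by (simp add: G_def B_def B2_def fps_compose_linear)
  then have "genocchi n / fact n = (- (2 ^ n - 1) * bernoulli n) / fact n"
    by (simp add: left_diff_distrib diff_divide_distrib)
  then show ?thesis by simp
qed

end
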